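(* Let $q-1=\ell s$ with $\ell, s$ positive integers, let $r_0,\ldots,r_{\ell-1}$ be positive integers and let $A_0,\ldots,A_{\ell-1}\in\mathbb{F}_q$. Define $P:\mathbb{F}_q\to\mathbb{F}_q$ by $P(0)=0$ and $P(x)=A_i x^{r_i}$ if $x\in C_i$, for $i=0,1,\ldots,\ell-1$. Then $P$ is a permutation polynomial (PP) of $\mathbb{F}_q$ if and only if $\gcd(r_i,s)=1$ for all $i=0,1,\ldots,\ell-1$ and $\mu_\ell=\{A_i^s\zeta^{r_i i}\mid i=0,\ldots,\ell-1\}$, where $\mu_\ell$ is the set of all $\ell$-th roots of unity in $\mathbb{F}_q$.
   Context: $q$ is a prime power, $\mathbb{F}_q$ the field with $q$ elements, $\gamma$ a fixed primitive element (generator of $\mathbb{F}_q^*$). $C_0=\{\gamma^{\ell j}: 0\le j\le s-1\}$ is the subgroup of index $\ell$ in $\mathbb{F}_q^*$, and $C_i=\gamma^i C_0$ for $0\le i\le \ell-1$ are the cyclotomic cosets. $\zeta=\gamma^s$ is a primitive $\ell$-th root of unity. A map (or polynomial) is a permutation polynomial (PP) of $\mathbb{F}_q$ if it induces a bijection of $\mathbb{F}_q$ to itself. *)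

theory Defs
  imports "HOL-Computational_Algebra.Computational_Algebra" "HOL-Library.Cardinality"
begin

definition primitive_element :: "'a::{field,finite} \<Rightarrow> bool" where
  "primitive_element g \<longleftrightarrow> g \<noteq> 0 \<and> (\<forall>x. x \<noteq> 0 \<longrightarrow> (\<exists>k::nat. x = g ^ k))"

definition cyclotomic_coset :: "'a::{field,finite} \<Rightarrow> nat \<Rightarrow> nat \<Rightarrow> nat \<Rightarrow> 'a set" where
  "cyclotomic_coset g l s i = (\<lambda>x. g ^ i * x) ` {g ^ (l * j) | j. j \<le> s - 1}"

definition roots_of_unity :: "nat \<Rightarrow> 'a::{field,finite} set" where
  "roots_of_unity l = {x. x ^ l = 1}"

text \<open>Every function on a finite field is induced by a polynomial, so a permutation polynomial
  is treated through the map it induces.\<close>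

definition permutation_polynomial :: "('a::{field,finite} \<Rightarrow> 'a) \<Rightarrow> bool" where
  "permutation_polynomial f \<longleftrightarrow> bij f"

end

theory Submission
  imports Defs "HOL-Number_Theory.Cong"
begin

text \<open>The \<open>s\<close>-th power map is constant on each coset and separates the cosets, and \<open>P(x)\<^sup>s = A\<^sub>i\<^sup>s \<zeta>\<^bsup>r\<^sub>i i\<^esup>\<close> on \<open>C\<^sub>i\<close>.
  Hence the set condition says that \<open>P\<close> permutes the cosets among themselves, and coprimality of
  \<open>r\<^sub>i\<close> and \<open>s\<close> says that \<open>P\<close> is injective on \<open>C\<^sub>i\<close>.\<close>

text \<open>Multiplication by \<open>a\<close> permutes the nonzero elements, so their product is
  unchanged when each is multiplied by \<open>a\<close>; cancelling this nonzero product leaves the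
  power of \<open>a\<close>.\<close>

lemma finite_field_power_card_minus_one:
  fixes a :: "'a::{field,finite}"
  assumes "a \<noteq> 0"
  shows "a ^ (CARD('a) - 1) = 1"
proof -
  have "bij_betw ((*) a) (UNIV - {0}) (UNIV - {0})"
    by (rule bij_betw_byWitness[of _ "(*) (inverse a)"]) (use assms in auto)
  then have "prod (\<lambda>x. x) (UNIV - {0 :: 'a}) = prod ((*) a) (UNIV - {0})"
    by (simp add: prod.reindex_bij_betw[where g = "\<lambda>x. x"])
  also have "\<dots> = a ^ (CARD('a) - 1) * prod (\<lambda>x. x) (UNIV - {0})"
    by (simp add: prod.distrib card_Diff_subset)
  finally show ?thesis
    by simp
qed

lemma finite_field_power_mod:
  fixes a :: "'a::{field,finite}"
  assumes "a \<noteq> 0"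
  shows "a ^ (k mod (CARD('a) - 1)) = a ^ k"
proof -
  have "a ^ k = a ^ ((CARD('a) - 1) * (k div (CARD('a) - 1)) + k mod (CARD('a) - 1))"
    by simp
  also have "\<dots> = a ^ (k mod (CARD('a) - 1))"
    unfolding power_add power_mult finite_field_power_card_minus_one[OF assms] by simp
  finally show ?thesis ..
qed

text \<open>Reducing exponents modulo \<open>CARD('a) - 1\<close> shows that the powers below that
  bound already cover all nonzero elements. There are exactly as many exponents as elements, so
  these powers are pairwise distinct.\<close>

lemma primitive_element_power_eq_iff:
  fixes g :: "'a::{field,finite}"
  assumes "primitive_element g"
  shows "g ^ a = g ^ b \<longleftrightarrow> [a = b] (mod (CARD('a) - 1))"
proof -
  define n where "n = CARD('a) - 1"
  have g0: "g \<noteq> 0"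
    using assms by (simp add: primitive_element_def)
  have card: "card (UNIV - {0 :: 'a}) = n"
    by (simp add: n_def card_Diff_subset)
  moreover have "UNIV - {0 :: 'a} \<noteq> {}"
    using g0 by blast
  ultimately have n: "n > 0"
    by (metis card_gt_0_iff finite)
  have "(\<lambda>k. g ^ k) ` {..<n} = UNIV - {0}"
  proof (intro equalityI subsetI)
    fix x assume "x \<in> UNIV - {0 :: 'a}"
    then obtain k where "x = g ^ k"
      using assms unfolding primitive_element_def by blast
    then have "x = g ^ (k mod n)"
      using finite_field_power_mod[OF g0] by (simp add: n_def)
    then show "x \<in> (\<lambda>k. g ^ k) ` {..<n}"
      using n by auto
  qed (use g0 in auto)
  then have "inj_on (\<lambda>k. g ^ k) {..<n}"
    using card by (intro eq_card_imp_inj_on) auto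
  moreover have "g ^ a = g ^ b \<longleftrightarrow> g ^ (a mod n) = g ^ (b mod n)"
    using finite_field_power_mod[OF g0] by (simp add: n_def)
  ultimately show ?thesis
    using n unfolding cong_def n_def[symmetric] inj_on_def by (metis lessThan_iff mod_less_divisor)
qed

text \<open>If \<open>g ^ k\<close> is a root of unity, then \<open>l * s\<close> divides
  \<open>k * l\<close>, so \<open>s\<close> divides \<open>k\<close>. Writing the roots as
  \<open>s\<close>-th powers makes them comparable with the values \<open>P x ^ s\<close>.\<close>

lemma roots_of_unity_eq:
  fixes g :: "'a::{field,finite}"
  assumes "primitive_element g" and "CARD('a) - 1 = l * s" and "l > 0"
  shows "roots_of_unity l = (\<lambda>m. (g ^ m) ^ s) ` {..<l}"
proof (intro equalityI subsetI)
  fix x :: 'a assume x: "x \<in> roots_of_unity l"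
  then have xl: "x ^ l = 1"
    by (simp add: roots_of_unity_def)
  with assms(3) have "x \<noteq> 0"
    by (auto simp: power_0_left)
  then obtain k where k: "x = g ^ k"
    using assms(1) unfolding primitive_element_def by blast
  have "g ^ (k * l) = g ^ 0"
    using xl k by (simp add: power_mult)
  then have "l * s dvd k * l"
    unfolding primitive_element_power_eq_iff[OF assms(1)] assms(2) cong_0_iff .
  then have "s dvd k"
    using assms(3) by (simp add: mult.commute)
  then obtain m where m: "k = s * m" ..
  have "s * (m mod l) mod (l * s) = s * m mod (l * s)"
    by (simp add: mult.commute[of l] flip: mult_mod_right)
  then have "x = g ^ (s * (m mod l))"
    using primitive_element_power_eq_iff[OF assms(1)] assms(2) k m by (simp add: cong_def)
  then show "x \<in> (\<lambda>m. (g ^ m) ^ s) ` {..<l}"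
    using assms(3) by (intro image_eqI[of _ _ "m mod l"]) (auto simp: mult.commute simp flip: power_mult)
next
  fix x assume "x \<in> (\<lambda>m. (g ^ m) ^ s) ` {..<l}"
  then obtain m where m: "x = (g ^ m) ^ s" by auto
  have "g ^ m \<noteq> 0"
    using assms(1) by (simp add: primitive_element_def)
  from finite_field_power_card_minus_one[OF this] show "x \<in> roots_of_unity l"
    using m assms(2) by (simp add: roots_of_unity_def mult_ac flip: power_mult)
qed

text \<open>The exponents \<open>m * s\<close> with \<open>m < l\<close> are distinct and below
  \<open>l * s\<close>. The count later turns the equality of sets into injectivity in the coset
  index.\<close>

lemma card_roots_of_unity:
  fixes g :: "'a::{field,finite}"
  assumes "primitive_element g" and "CARD('a) - 1 = l * s" and "l > 0" and "s > 0"
  shows "card (roots_of_unity l :: 'a set) = l"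
proof -
  have "inj_on (\<lambda>m. (g ^ m) ^ s) {..<l}"
  proof (rule inj_onI)
    fix m m' assume m: "m \<in> {..<l}" "m' \<in> {..<l}" and "(g ^ m) ^ s = (g ^ m') ^ s"
    then have "[m * s = m' * s] (mod (l * s))"
      using primitive_element_power_eq_iff[OF assms(1)] assms(2) by (simp flip: power_mult)
    then show "m = m'"
      using m assms(4) by (simp add: cong_def flip: mult_mod_left)
  qed
  then show ?thesis
    by (simp add: roots_of_unity_eq[OF assms(1-3)] card_image)
qed

lemma in_cyclotomic_coset_iff:
  fixes g :: "'a::{field,finite}"
  assumes "s > 0"
  shows "x \<in> cyclotomic_coset g l s i \<longleftrightarrow> (\<exists>j<s. x = g ^ (i + l * j))"
proof -
  have "j \<le> s - 1 \<longleftrightarrow> j < s" for j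
    using assms by linarith
  then show ?thesis
    unfolding cyclotomic_coset_def by (auto simp: power_add)
qed

text \<open>Reduce the exponent of \<open>x\<close> below \<open>l * s\<close> and divide by
  \<open>l\<close>: the remainder is the coset index, and the quotient, being below
  \<open>s\<close>, is the position within the coset.\<close>

lemma cyclotomic_coset_exhaust:
  fixes g x :: "'a::{field,finite}"
  assumes "primitive_element g" and "CARD('a) - 1 = l * s" and "l > 0" and "s > 0" and "x \<noteq> 0"
  obtains i where "i < l" and "x \<in> cyclotomic_coset g l s i"
proof -
  obtain k where k: "x = g ^ k"
    using assms(1,5) unfolding primitive_element_def by blast
  define k' where "k' = k mod (l * s)"
  have "x = g ^ k'"
    using finite_field_power_mod[of g k] assms(1,2) k by (simp add: primitive_element_def k'_def)
  then have "x = g ^ (k' mod l + l * (k' div l))"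
    by simp
  moreover have "k' div l < s"
    using assms(3,4) by (simp add: k'_def div_less_iff_less_mult mult.commute)
  ultimately have "x \<in> cyclotomic_coset g l s (k' mod l)"
    using in_cyclotomic_coset_iff[OF assms(4)] by blast
  then show thesis
    using that[of "k' mod l"] assms(3) by simp
qed

theorem theorem1p1:
  fixes \<gamma> \<zeta> :: "'a::{field,finite}"
    and l s :: nat
    and r :: "nat \<Rightarrow> nat"
    and A :: "nat \<Rightarrow> 'a"
    and P :: "'a \<Rightarrow> 'a"
  assumes gamma: "primitive_element \<gamma>"
    and card: "CARD('a) - 1 = l * s"
    and l_pos: "l > 0"
    and s_pos: "s > 0"
    and zeta: "\<zeta> = \<gamma> ^ s"
    and r_pos: "\<And>i. i < l \<Longrightarrow> r i > 0"
    and P_zero: "P 0 = 0"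
    and P_coset: "\<And>i x. i < l \<Longrightarrow> x \<in> cyclotomic_coset \<gamma> l s i \<Longrightarrow> P x = A i * x ^ r i"
  shows "permutation_polynomial P \<longleftrightarrow>
    (\<forall>i<l. gcd (r i) s = 1) \<and> roots_of_unity l = {A i ^ s * \<zeta> ^ (r i * i) | i. i < l}"
proof -
  have nz: "\<gamma> \<noteq> 0"
    using gamma by (simp add: primitive_element_def)
  note eq_iff = primitive_element_power_eq_iff[OF gamma, unfolded card]
  note coset_iff = in_cyclotomic_coset_iff[OF s_pos]
  note exhaust = cyclotomic_coset_exhaust[OF gamma card l_pos s_pos]
  let ?f = "\<lambda>i. A i ^ s * \<zeta> ^ (r i * i)"
  have image: "{?f i | i. i < l} = ?f ` {..<l}"
    by auto
  have P_pow: "P x ^ s = ?f i" if i: "i < l" and x: "x \<in> cyclotomic_coset \<gamma> l s i" for i x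
  proof -
    obtain j where "x = \<gamma> ^ (i + l * j)"
      using x unfolding coset_iff by blast
    \<comment> \<open>The contribution of \<open>j\<close> to the exponent is a multiple of
      \<open>l * s\<close>, hence the value depends on the coset only.\<close>
    moreover have "\<gamma> ^ ((i + l * j) * (r i * s)) = \<gamma> ^ (s * (r i * i))"
      unfolding eq_iff
    proof -
      have "(i + l * j) * (r i * s) = s * (r i * i) + (l * s) * (j * r i)"
        by (simp add: algebra_simps)
      then show "[(i + l * j) * (r i * s) = s * (r i * i)] (mod (l * s))"
        by (simp only: cong_def mod_mult_self2)
    qed
    ultimately have "x ^ (r i * s) = \<zeta> ^ (r i * i)"
      by (simp add: zeta flip: power_mult)
    then show ?thesis
      by (simp add: P_coset[OF i x] power_mult_distrib flip: power_mult)
  qed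
  \<comment> \<open>Both values of \<open>P\<close> share the nonzero factor
    \<open>A i * \<gamma> ^ (i * r i)\<close>. What remains is a congruence modulo
    \<open>l * s\<close> with the factor \<open>l\<close> on both sides, and dividing by
    \<open>l\<close> leaves the modulus \<open>s\<close>.\<close>
  have cancel: "[r i * j = r i * j'] (mod s) \<longleftrightarrow> P (\<gamma> ^ (i + l * j)) = P (\<gamma> ^ (i + l * j'))"
    if "i < l" "j < s" "j' < s" "A i \<noteq> 0" for i j j'
  proof -
    have Pj: "P (\<gamma> ^ (i + l * j)) = A i * \<gamma> ^ (i * r i) * \<gamma> ^ (l * (r i * j))"
      if "j < s" for j
    proof -
      have "\<gamma> ^ (i + l * j) \<in> cyclotomic_coset \<gamma> l s i"
        using coset_iff that by blast
      from P_coset[OF \<open>i < l\<close> this] show ?thesis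
        by (simp add: algebra_simps flip: power_mult power_add)
    qed
    show ?thesis
      using that nz l_pos by (simp add: Pj eq_iff cong_def flip: mult_mod_right)
  qed
  show ?thesis
    unfolding permutation_polynomial_def image
  proof
    assume bij: "bij P"
    then have inj: "P x = P y \<Longrightarrow> x = y" for x y
      by (simp add: bij_def inj_eq)
    have P_nz: "P x \<noteq> 0" if "x \<noteq> 0" for x
      using inj[of x 0] that P_zero by auto
    have self: "\<gamma> ^ i \<in> cyclotomic_coset \<gamma> l s i" for i
      using s_pos coset_iff[of "\<gamma> ^ i"] by force
    have "gcd (r i) s = 1" if i: "i < l" for i
    proof (rule ccontr)
      assume ne: "gcd (r i) s \<noteq> 1"
      \<comment> \<open>When the gcd exceeds 1, this is a position strictly between 0 and
        \<open>s\<close> for which \<open>s\<close> divides \<open>r i * ?t\<close>. Positions 0 and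
        \<open>?t\<close> of the coset then have the same image, against injectivity.\<close>
      let ?t = "s div gcd (r i) s"
      have "gcd (r i) s > 0"
        using s_pos by simp
      with ne have "gcd (r i) s > 1"
        by linarith
      with s_pos have t: "?t < s" "?t > 0"
        by (simp_all add: div_greater_zero_iff)
      have "r i * ?t = r i div gcd (r i) s * s"
        by (metis div_mult_swap dvd_div_mult gcd_dvd1 gcd_dvd2)
      then have "[r i * ?t = r i * 0] (mod s)"
        by (simp add: cong_def)
      moreover have "A i \<noteq> 0"
        using P_nz[of "\<gamma> ^ i"] P_coset[OF i self] nz by auto
      ultimately have "\<gamma> ^ (i + l * ?t) = \<gamma> ^ (i + l * 0)"
        using cancel[OF i t(1) s_pos] inj by blast
      then have "[l * ?t = l * 0] (mod (l * s))"
        unfolding eq_iff by (rule cong_add_lcancel_nat[THEN iffD1])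
      then show False
        using t l_pos by (simp add: cong_def flip: mult_mod_right)
    qed
    moreover have "roots_of_unity l = ?f ` {..<l}"
    proof (intro equalityI subsetI)
      fix w :: 'a assume "w \<in> roots_of_unity l"
      then obtain m where w: "w = (\<gamma> ^ m) ^ s"
        using roots_of_unity_eq[OF gamma card l_pos] by auto
      \<comment> \<open>Surjectivity of \<open>P\<close> gives a preimage of the base
        \<open>\<gamma> ^ m\<close>; the coset of \<open>x\<close> is the index that produces
        \<open>w\<close>.\<close>
      obtain x where x: "\<gamma> ^ m = P x"
        using bij by (meson bij_pointE)
      then have "x \<noteq> 0"
        using nz P_zero by auto
      then obtain i where "i < l" "x \<in> cyclotomic_coset \<gamma> l s i"
        by (rule exhaust)
      then show "w \<in> ?f ` {..<l}"
        using P_pow w x by auto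
    next
      fix w assume "w \<in> ?f ` {..<l}"
      then obtain i where "i < l" "w = P (\<gamma> ^ i) ^ s"
        using P_pow[OF _ self] by auto
      \<comment> \<open>\<open>w ^ l\<close> is the nonzero element \<open>P (\<gamma> ^ i)\<close>
        raised to \<open>l * s\<close>, the order of the multiplicative group.\<close>
      then show "w \<in> roots_of_unity l"
        using finite_field_power_card_minus_one[OF P_nz[of "\<gamma> ^ i"]] nz card
        by (simp add: roots_of_unity_def mult.commute flip: power_mult)
    qed
    ultimately show "(\<forall>i<l. gcd (r i) s = 1) \<and> roots_of_unity l = ?f ` {..<l}"
      by blast
  next
    assume *: "(\<forall>i<l. gcd (r i) s = 1) \<and> roots_of_unity l = ?f ` {..<l}"
    \<comment> \<open>The \<open>l\<close> indices have an image of \<open>l\<close> elements, so no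
      two of them share a value.\<close>
    then have inj_f: "inj_on ?f {..<l}"
      using card_roots_of_unity[OF gamma card l_pos s_pos] by (intro eq_card_imp_inj_on) auto
    \<comment> \<open>A vanishing coefficient would make 0 a root of unity, because \<open>s\<close>
      is positive.\<close>
    have A_nz: "A i \<noteq> 0" if "i < l" for i
    proof
      assume "A i = 0"
      then have "0 \<in> (roots_of_unity l :: 'a set)"
        using * that s_pos by (auto simp: power_0_left intro!: image_eqI[of _ _ i])
      then show False
        using l_pos by (simp add: roots_of_unity_def power_0_left)
    qed
    have P_nz: "P x \<noteq> 0" if "x \<noteq> 0" for x
      using exhaust[OF that] P_coset A_nz that by (metis mult_eq_0_iff power_not_zero)
    have "x = y" if eq: "P x = P y" for x y
    proof (cases "x = 0 \<or> y = 0")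
      case True
      then show ?thesis
        using eq P_nz P_zero by metis
    next
      case False
      obtain i where i: "i < l" "x \<in> cyclotomic_coset \<gamma> l s i"
        using False exhaust by blast
      obtain i' where i': "i' < l" "y \<in> cyclotomic_coset \<gamma> l s i'"
        using False exhaust by blast
      \<comment> \<open>Equal images have equal \<open>s\<close>-th powers, which determine the
        coset index by \<open>inj_f\<close>; it remains to compare positions within one
        coset.\<close>
      have "?f i = ?f i'"
        using P_pow[OF i] P_pow[OF i'] eq by simp
      then have "i' = i"
        using inj_f i i' by (simp add: inj_on_def)
      then obtain j j' where j: "j < s" "x = \<gamma> ^ (i + l * j)" "j' < s" "y = \<gamma> ^ (i + l * j')"
        using i i' unfolding coset_iff by blast
      then have "[r i * j = r i * j'] (mod s)"
        using cancel[OF i(1) j(1) j(3) A_nz[OF i(1)]] eq by simp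
      \<comment> \<open>Coprimality allows \<open>r i\<close> to be cancelled; as both positions are
        below \<open>s\<close>, the congruence is then an equality.\<close>
      then have "[j = j'] (mod s)"
        using * i(1) by (simp add: cong_mult_lcancel_nat coprime_iff_gcd_eq_1)
      then show ?thesis
        using j by (simp add: cong_def)
    qed
    then show "bij P"
      by (simp add: bij_def inj_def finite_UNIV_inj_surj)
  qed
qed

end
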